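(* Let $p$ be a prime number and $0\neq f(t)\in\mathbb{Z}[t]$. Then the $p$-power-th cyclic resultants $\mathrm{Res}(t^{p^n}-1,f(t))$ converge in $\mathbb{Z}_p$ as $n\to\infty$, and the limit is $0$ if and only if $p\mid f(1)$. In any case, if $\mathrm{Res}(t^{p^n}-1,f(t))\neq 0$ for every $n$, then the non-$p$-parts of $\mathrm{Res}(t^{p^n}-1,f(t))$ converge in $\mathbb{Z}_p$ to a non-zero value. Moreover, for each prime number $l$, similar assertions hold for the $l$-parts of $\mathrm{Res}(t^{p^n}-1,f(t))$; in particular these $l$-parts converge in $\mathbb{Z}_p$.
   Context: For $n\in\mathbb{Z}_{>0}$, $\mathrm{Res}(t^n-1,f(t))=\prod_{\zeta^n=1}f(\zeta)$, the product over all $n$-th roots of unity in $\overline{\mathbb{Q}}$; it is an integer. The non-$p$ part of a nonzero integer $x=mp^r$ with $p\nmid m$, $r\ge0$, is $m$ (i.e. $x\,|x|_p$). For a prime $l$, the $l$-part of a nonzero integer $x$ is the largest power of $l$ dividing $x$, i.e. $|x|_l^{-1}$. *)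

theory Defs
  imports "HOL-Computational_Algebra.Computational_Algebra"
begin

text \<open>Cyclic resultant Res(t^n - 1, f(t)) = product of f(zeta) over all n-th roots of unity
  zeta (taken in the complex numbers); this is an integer, and we take that integer.\<close>
definition cyc_res :: "nat \<Rightarrow> int poly \<Rightarrow> int" where
  "cyc_res n f = (THE r::int. of_int r =
     (\<Prod>z\<in>{z::complex. z ^ n = 1}. poly (map_poly of_int f) z))"

definition non_p_part :: "nat \<Rightarrow> int \<Rightarrow> int" where
  "non_p_part p x = x div (int p ^ multiplicity (int p) x)"

definition l_part :: "nat \<Rightarrow> int \<Rightarrow> int" where
  "l_part l x = int l ^ multiplicity (int l) x"

text \<open>A sequence of integers converges in Z_p iff it is p-adically Cauchy.\<close>
definition padic_convergent :: "nat \<Rightarrow> (nat \<Rightarrow> int) \<Rightarrow> bool" where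
  "padic_convergent p a \<longleftrightarrow>
     (\<forall>k. \<exists>N. \<forall>m\<ge>N. \<forall>n\<ge>N. int p ^ k dvd a m - a n)"

definition padic_tendsto_zero :: "nat \<Rightarrow> (nat \<Rightarrow> int) \<Rightarrow> bool" where
  "padic_tendsto_zero p a \<longleftrightarrow> (\<forall>k. \<exists>N. \<forall>n\<ge>N. int p ^ k dvd a n)"

end

theory Submission
  imports Defs "HOL-Algebra.Sylow" "HOL-Algebra.FiniteProduct" "HOL-Number_Theory.Cong"
begin

text \<open>The resultant at level \<open>p ^ Suc k\<close> is the one at level \<open>p ^ k\<close> times the norm \<open>N\<close> of
  \<open>f(\<zeta>)\<close>, \<open>\<zeta>\<close> a primitive \<open>p ^ Suc k\<close>-th root of unity, and \<open>N \<equiv> f(1) ^ D\<close> modulo \<open>p\<close>,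
  where \<open>D\<close> is the degree of the \<open>p ^ Suc k\<close>-th cyclotomic polynomial \<open>\<Phi>\<close>. All
  convergence statements follow once the \<open>l\<close>-part of \<open>N\<close> is known to be \<open>1\<close> modulo \<open>p ^ Suc k\<close> for
  every prime \<open>l \<noteq> p\<close>; since \<open>N\<close> is positive for \<open>k > 0\<close>, its non-\<open>p\<close>-part is the product of
  these \<open>l\<close>-parts.

  The quotient \<open>\<int>[t] / (\<Phi>, f)\<close> has \<open>\<bar>N\<bar>\<close> elements: its cardinality is multiplicative in \<open>f\<close> and
  invariant under \<open>t \<mapsto> t ^ a\<close>, and the product of the conjugates \<open>f(t ^ a)\<close> is the constant \<open>N\<close>,
  whose quotient has \<open>\<bar>N\<bar> ^ D\<close> elements. Multiplication by \<open>t\<close> has order \<open>p ^ Suc k\<close> on the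
  \<open>l\<close>-primary part of this group and moves the nonzero elements freely, because an element fixed by
  a nontrivial power of \<open>t\<close> is killed by \<open>p\<close>. Counting orbits gives the congruence.\<close>

subsection \<open>Primary parts and free orbits\<close>

text \<open>Sylow gives a subgroup \<open>H\<close> of order \<open>l ^ v\<close>, and the set in
  question is \<open>H\<close> itself. Since \<open>G Mod H\<close> has order \<open>m\<close>, the
  power \<open>x [^] m\<close> lies in \<open>H\<close>; as \<open>m\<close> is invertible modulo
  \<open>l ^ v\<close>, an \<open>x\<close> killed by \<open>l ^ v\<close> is a power of
  \<open>x [^] m\<close>. The converse is Lagrange in \<open>H\<close>.\<close>

lemma (in comm_group) card_primary_part:
  assumes fin: "finite (carrier G)" and l: "prime l"
    and ord: "Coset.order G = l ^ v * m" and m: "\<not> l dvd m"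
  shows "card {x \<in> carrier G. x [^] (l ^ v) = \<one>} = l ^ v"
proof -
  obtain H where H: "subgroup H G" "card H = l ^ v"
    using sylow_thm[OF l is_group ord fin] by blast
  interpret H: normal H G
    by (rule subgroup_imp_normal) (rule H(1))
  interpret Q: comm_group "G Mod H"
    by (rule abelian_FactGroup) (rule H(1))
  interpret K: comm_group "G\<lparr>carrier := H\<rparr>"
  proof (rule group.group_comm_groupI)
    show "group (G\<lparr>carrier := H\<rparr>)"
      using H.subgroup_is_group is_group by blast
  qed (use H.subset in \<open>auto intro: m_comm\<close>)
  have lv: "l ^ v > 0" using l by (simp add: prime_gt_0_nat)
  have cardQ: "card (carrier (G Mod H)) = m"
    using lagrange[OF H(1)] H(2) ord lv by (auto simp: FactGroup_def mult.commute)
  have finQ: "finite (carrier (G Mod H))"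
    by (simp add: carrier_FactGroup fin)
  have finH: "finite H"
    using fin H(1) finite_subset subgroup.subset by blast
  have "x \<in> H" if x: "x \<in> carrier G" "x [^] (l ^ v) = \<one>" for x
  proof -
    have xm: "H #> (x [^] m) = H"
    proof -
      have "H #> x \<in> carrier (G Mod H)" using x by (simp add: carrier_FactGroup)
      from Q.power_order_eq_one[OF finQ this] show ?thesis
        using x by (simp add: cardQ H.FactGroup_pow)
    qed
    have xmH: "x [^] m \<in> H"
      using coset_join1[OF xm] x H(1) by simp
    have "coprime m (l ^ v)"
      using l m by (simp add: prime_imp_coprime coprime_commute)
    hence "gcd m (l ^ v) = 1" by simp
    moreover have "m \<noteq> 0" using m by (metis dvd_0_right)
    ultimately obtain a b where ab: "m * a = l ^ v * b + 1"
      using bezout_nat by metis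
    have "(x [^] m) [^] a = x [^] (l ^ v * b + 1)"
      using x by (simp add: nat_pow_pow ab)
    also have "\<dots> = (x [^] (l ^ v)) [^] b \<otimes> x"
      using x(1) by (simp add: nat_pow_pow flip: nat_pow_mult)
    also have "\<dots> = x" using x by simp
    finally have "x = (x [^] m) [^] a" ..
    thus "x \<in> H" using xmH K.nat_pow_closed[of "x [^] m" a]
      by (simp add: nat_pow_consistent[symmetric])
  qed
  moreover have "x [^] (l ^ v) = \<one>" if "x \<in> H" for x
    using K.power_order_eq_one[of x] that finH H(2) by (simp add: nat_pow_consistent[symmetric])
  ultimately have "{x \<in> carrier G. x [^] (l ^ v) = \<one>} = H"
    using H.subset by blast
  thus ?thesis using H(2) by simp
qed

text \<open>The orbits partition \<open>Y\<close>, and each has exactly \<open>q\<close> elements,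
  because a coincidence between two iterates would yield a period shorter than
  \<open>q\<close>.\<close>

lemma dvd_card_if_free_orbits:
  fixes g :: "'a \<Rightarrow> 'a"
  assumes fin: "finite Y" and q: "q > 0"
    and closed: "\<And>y. y \<in> Y \<Longrightarrow> g y \<in> Y"
    and period: "\<And>y. y \<in> Y \<Longrightarrow> (g ^^ q) y = y"
    and free: "\<And>y i. y \<in> Y \<Longrightarrow> 0 < i \<Longrightarrow> i < q \<Longrightarrow> (g ^^ i) y \<noteq> y"
  shows "q dvd card Y"
proof -
  define orb where "orb y = (\<lambda>i. (g ^^ i) y) ` {..<q}" for y
  have closed': "(g ^^ i) y \<in> Y" if "y \<in> Y" for i y
    using that by (induction i) (auto intro: closed)
  have per: "(g ^^ (q * j)) y = y" if "y \<in> Y" for j y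
    using that by (induction j) (auto simp: funpow_add period)
  have red: "(g ^^ i) y = (g ^^ (i mod q)) y" if "y \<in> Y" for i y
  proof -
    have "(g ^^ i) y = (g ^^ (i mod q + q * (i div q))) y" by simp
    also have "\<dots> = (g ^^ (i mod q)) y"
      unfolding funpow_add using per[OF that] by simp
    finally show ?thesis .
  qed
  have inorb: "(g ^^ i) y \<in> orb y" if "y \<in> Y" for i y
    using red[OF that, of i] q unfolding orb_def by auto
  have inj: "inj_on (\<lambda>i. (g ^^ i) y) {..<q}" if y: "y \<in> Y" for y
  proof (rule linorder_inj_onI)
    fix i j assume ij: "i < j" "i \<in> {..<q}" "j \<in> {..<q}"
    show "(g ^^ i) y \<noteq> (g ^^ j) y"
    proof
      assume eq: "(g ^^ i) y = (g ^^ j) y"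
      have "(g ^^ (q - i + i)) y = (g ^^ (q - i + j)) y"
        unfolding funpow_add using eq by simp
      hence "y = (g ^^ (q + (j - i))) y"
        using ij period[OF y] by (simp add: add.commute)
      also have "\<dots> = (g ^^ (j - i)) y"
        unfolding funpow_add using period[OF closed'[OF y]] by simp
      finally have "(g ^^ (j - i)) y = y" by simp
      moreover have "0 < j - i" "j - i < q" using ij by auto
      ultimately show False using free[OF y] by blast
    qed
  qed auto
  have sub: "orb ((g ^^ i) y) \<subseteq> orb y" if "y \<in> Y" for i y
  proof
    fix x assume "x \<in> orb ((g ^^ i) y)"
    then obtain j where "x = (g ^^ j) ((g ^^ i) y)" unfolding orb_def by blast
    hence "x = (g ^^ (j + i)) y" by (simp add: funpow_add)
    thus "x \<in> orb y" using inorb[OF that] by simp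
  qed
  have eqorb: "orb x = orb y" if y: "y \<in> Y" and x: "x \<in> orb y" for x y
  proof -
    obtain i where i: "i < q" "x = (g ^^ i) y" using x unfolding orb_def by blast
    \<comment> \<open>The remaining \<open>q - i\<close> iterations lead from \<open>x\<close> back
      to \<open>y\<close>, so each orbit contains the other.\<close>
    have "(g ^^ (q - i)) x = (g ^^ (q - i + i)) y" unfolding funpow_add i(2) by simp
    hence "(g ^^ (q - i)) x = y" using i period[OF y] by simp
    thus ?thesis using sub[OF y, of i] sub[OF closed'[OF y, of i], of "q - i"] i(2) by auto
  qed
  have "q * card (orb ` Y) = card (\<Union>(orb ` Y))"
  proof (rule card_partition)
    show "finite (orb ` Y)" using fin by simp
    show "finite (\<Union>(orb ` Y))" using fin by (auto simp: orb_def)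
    show "card c = q" if "c \<in> orb ` Y" for c
      using that inj unfolding orb_def by (auto simp: card_image)
    show "c1 \<inter> c2 = {}" if "c1 \<in> orb ` Y" "c2 \<in> orb ` Y" "c1 \<noteq> c2" for c1 c2
      using that eqorb by blast
  qed
  moreover have "\<Union>(orb ` Y) = Y"
    using closed' inorb[of _ 0] unfolding orb_def by auto
  ultimately show ?thesis by (metis dvd_triv_left)
qed

subsection \<open>Ideals of integer polynomials\<close>

definition ev :: "int poly \<Rightarrow> complex \<Rightarrow> complex" where
  "ev f z = poly (map_poly of_int f) z"

lemma ev_pCons [simp]: "ev (pCons a f) z = of_int a + z * ev f z"
  by (simp add: ev_def map_poly_pCons)

lemma ev_0 [simp]: "ev 0 z = 0"
  by (simp add: ev_def)

lemma ev_1 [simp]: "ev 1 z = 1"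
  by (simp add: one_pCons)

lemma ev_add [simp]: "ev (f + g) z = ev f z + ev g z"
  by (induction f g rule: poly_induct2) (auto simp: algebra_simps)

lemma ev_minus [simp]: "ev (- f) z = - ev f z"
  by (induction f) auto

lemma ev_diff [simp]: "ev (f - g) z = ev f z - ev g z"
  using ev_add[of f "- g" z] by simp

lemma ev_smult [simp]: "ev (smult c f) z = of_int c * ev f z"
  by (induction f) (auto simp: algebra_simps)

lemma ev_mult [simp]: "ev (f * g) z = ev f z * ev g z"
  by (induction f) (auto simp: algebra_simps)

lemma ev_sum [simp]: "ev (\<Sum>i\<in>A. f i) z = (\<Sum>i\<in>A. ev (f i) z)"
  by (induction A rule: infinite_finite_induct) auto

lemma ev_prod [simp]: "ev (\<Prod>i\<in>A. f i) z = (\<Prod>i\<in>A. ev (f i) z)"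
  by (induction A rule: infinite_finite_induct) auto

lemma ev_monom [simp]: "ev (monom c n) z = of_int c * z ^ n"
  by (simp add: ev_def map_poly_monom poly_monom)

lemma ev_pcompose [simp]: "ev (pcompose f g) z = ev f (ev g z)"
  by (induction f) (auto simp: pcompose_pCons)

lemma ev_of_int [simp]: "ev (of_int c) z = of_int c"
  by (simp add: of_int_poly)

lemma ev_of_nat [simp]: "ev (of_nat c) z = of_nat c"
  using ev_of_int[of "int c" z] by simp

lemma ev_at_1: "ev f 1 = of_int (poly f 1)"
  by (induction f) auto

lemma cnj_ev: "cnj (ev f z) = ev f (cnj z)"
  by (induction f) auto

lemma ev_eq_0_imp_zero:
  assumes "finite P" "degree f < card P" "\<And>z. z \<in> P \<Longrightarrow> ev f z = 0"
  shows "f = 0"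
proof (rule ccontr)
  assume "f \<noteq> 0"
  hence nz: "map_poly of_int f \<noteq> (0 :: complex poly)"
    by (simp add: map_poly_eq_0_iff)
  have "card P \<le> card {z :: complex. poly (map_poly of_int f) z = 0}"
    using assms(3) nz poly_roots_finite by (intro card_mono) (auto simp: ev_def)
  also have "\<dots> \<le> degree (map_poly of_int f :: complex poly)"
    by (rule card_poly_roots_bound) (rule nz)
  also have "\<dots> \<le> degree f" by (rule degree_le) (simp add: coeff_map_poly coeff_eq_0)
  finally show False using assms(2) by simp
qed

section \<open>Residue classes of integer polynomials modulo an ideal\<close>

locale int_poly_ideal =
  fixes I :: "int poly set"
  assumes zero_mem: "0 \<in> I"
    and add_mem: "x \<in> I \<Longrightarrow> y \<in> I \<Longrightarrow> x + y \<in> I"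
    and mult_mem: "x \<in> I \<Longrightarrow> c * x \<in> I"
begin

lemma minus_mem: "x \<in> I \<Longrightarrow> - x \<in> I"
  using mult_mem[of x "-1"] by simp

lemma diff_mem: "x \<in> I \<Longrightarrow> y \<in> I \<Longrightarrow> x - y \<in> I"
  using add_mem[of x "- y"] minus_mem[of y] by simp

lemma diff_mem_trans: "x - y \<in> I \<Longrightarrow> y - z \<in> I \<Longrightarrow> x - z \<in> I"
  using add_mem[of "x - y" "y - z"] by simp

lemma diff_mem_sym: "x - y \<in> I \<Longrightarrow> y - x \<in> I"
  using minus_mem[of "x - y"] by simp

text \<open>\<open>SOME\<close> sees only the predicate \<open>\<lambda>y. x - y \<in> I\<close>,
  which is the same for congruent polynomials, so the choice depends on the residue class alone.
  Classes thus become polynomials.\<close>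

definition rep :: "int poly \<Rightarrow> int poly" where
  "rep x = (SOME y. x - y \<in> I)"

lemma diff_rep_mem: "x - rep x \<in> I"
  unfolding rep_def by (rule someI[of _ x]) (simp add: zero_mem)

lemma rep_eq_iff: "rep x = rep y \<longleftrightarrow> x - y \<in> I"
proof
  assume "rep x = rep y"
  thus "x - y \<in> I"
    using diff_rep_mem[of x] diff_rep_mem[of y] diff_mem_trans diff_mem_sym by metis
next
  assume "x - y \<in> I"
  hence "(\<lambda>z. x - z \<in> I) = (\<lambda>z. y - z \<in> I)"
    using diff_mem_trans diff_mem_sym by metis
  thus "rep x = rep y" unfolding rep_def by simp
qed

lemma rep_rep [simp]: "rep (rep x) = rep x"
  using rep_eq_iff diff_rep_mem diff_mem_sym by blast

lemma rep_add_rep [simp]: "rep (rep x + y) = rep (x + y)" "rep (y + rep x) = rep (y + x)"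
  using diff_mem_sym[OF diff_rep_mem[of x]] by (auto simp: rep_eq_iff)

lemma rep_mult_rep [simp]: "rep (c * rep x) = rep (c * x)"
  using mult_mem[OF diff_mem_sym[OF diff_rep_mem[of x]], of c]
  by (auto simp: rep_eq_iff algebra_simps)

text \<open>The additive group of \<int>[t]/I in multiplicative notation, so that Sylow's theorem
  applies to it; a power of an element is an integer multiple of the class.\<close>

definition quotient_group :: "int poly monoid" where
  "quotient_group = \<lparr>carrier = range rep, monoid.mult = (\<lambda>x y. rep (x + y)), one = rep 0\<rparr>"

lemma comm_group_quotient: "comm_group quotient_group"
proof (rule comm_groupI)
  fix x assume "x \<in> carrier quotient_group"
  then obtain y where y: "x = rep y" by (auto simp: quotient_group_def)
  show "\<exists>y\<in>carrier quotient_group. y \<otimes>\<^bsub>quotient_group\<^esub> x = \<one>\<^bsub>quotient_group\<^esub>"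
    by (rule bexI[of _ "rep (- y)"])
       (use diff_mem_sym[OF diff_rep_mem[of y]] in \<open>auto simp: quotient_group_def y rep_eq_iff\<close>)
qed (auto simp: quotient_group_def algebra_simps)

lemma pow_quotient:
  "x \<in> range rep \<Longrightarrow> x [^]\<^bsub>quotient_group\<^esub> (n :: nat) = rep (of_nat n * x)"
proof (induction n)
  case 0
  thus ?case by (simp add: quotient_group_def nat_pow_def)
next
  case (Suc n)
  have "x [^]\<^bsub>quotient_group\<^esub> Suc n = rep (x [^]\<^bsub>quotient_group\<^esub> n + x)"
    by (simp add: quotient_group_def nat_pow_def)
  thus ?case using Suc by (simp add: algebra_simps)
qed

definition transversal :: "int poly set \<Rightarrow> bool" where
  "transversal T \<longleftrightarrow> (\<forall>x. \<exists>t\<in>T. x - t \<in> I) \<and> (\<forall>s\<in>T. \<forall>t\<in>T. s - t \<in> I \<longrightarrow> s = t)"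

lemma transversal_rep: "transversal (range rep)"
  unfolding transversal_def using diff_rep_mem rep_eq_iff by (metis rangeE rangeI rep_rep)

text \<open>The index of \<open>I\<close> in \<int>[t], with value 0 if the quotient is
  infinite.\<close>

definition index :: nat where
  "index = card (range rep)"

lemma card_transversal: "card T = index" if T: "transversal T"
proof -
  have "inj_on rep T"
    using T unfolding transversal_def inj_on_def rep_eq_iff by blast
  moreover have "rep ` T = range rep"
  proof (rule antisym)
    show "range rep \<subseteq> rep ` T"
    proof
      fix y assume "y \<in> range rep"
      then obtain x where "y = rep x" by blast
      moreover obtain t where "t \<in> T" "x - t \<in> I" using T unfolding transversal_def by blast
      ultimately show "y \<in> rep ` T" using rep_eq_iff by blast
    qed
  qed auto
  ultimately show ?thesis unfolding index_def by (metis card_image)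
qed

end

text \<open>The ideal \<open>h\<int>[t]\<close> of the ring of integer polynomial functions on \<open>P\<close>, pulled back to
  \<open>\<int>[t]\<close>. Over the roots \<open>P\<close> of a cyclotomic polynomial \<open>\<Phi>\<close> this is the ideal \<open>(\<Phi>, h)\<close>.\<close>
definition ideal_on :: "complex set \<Rightarrow> int poly \<Rightarrow> int poly set" where
  "ideal_on P h = {x. \<exists>a. \<forall>z\<in>P. ev x z = ev h z * ev a z}"

lemma int_poly_ideal_ideal_on: "int_poly_ideal (ideal_on P h)"
proof
  show "0 \<in> ideal_on P h" unfolding ideal_on_def by (auto intro!: exI[of _ 0])
next
  fix x y assume "x \<in> ideal_on P h" "y \<in> ideal_on P h"
  then obtain a b where "\<forall>z\<in>P. ev x z = ev h z * ev a z" "\<forall>z\<in>P. ev y z = ev h z * ev b z"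
    unfolding ideal_on_def by blast
  thus "x + y \<in> ideal_on P h"
    unfolding ideal_on_def by (auto simp: algebra_simps intro!: exI[of _ "a + b"])
next
  fix x c assume "x \<in> ideal_on P h"
  then obtain a where "\<forall>z\<in>P. ev x z = ev h z * ev a z"
    unfolding ideal_on_def by blast
  thus "c * x \<in> ideal_on P h"
    unfolding ideal_on_def by (auto simp: algebra_simps intro!: exI[of _ "c * a"])
qed

interpretation ideal_on: int_poly_ideal "ideal_on P h" for P h
  by (rule int_poly_ideal_ideal_on)

section \<open>Multiplicativity of the index and invariance under substitutions\<close>

abbreviation idx :: "complex set \<Rightarrow> int poly \<Rightarrow> nat" where
  "idx P h \<equiv> int_poly_ideal.index (ideal_on P h)"

lemma ideal_on_cong:
  "(\<And>z. z \<in> P \<Longrightarrow> ev g z = ev h z) \<Longrightarrow> ideal_on P g = ideal_on P h"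
  unfolding ideal_on_def by simp

lemma idx_1: "idx P 1 = 1"
proof -
  have "ideal_on.transversal P 1 {0}"
    unfolding ideal_on.transversal_def by (auto simp: ideal_on_def)
  from ideal_on.card_transversal[OF this] show ?thesis by simp
qed

text \<open>If \<open>s\<close> and \<open>t\<close> run through transversals for \<open>g\<close>
  and \<open>h\<close>, then \<open>s + g * t\<close> runs through one for \<open>g * h\<close>.
  Reducing modulo \<open>g\<close> recovers \<open>s\<close>; cancelling the nonzero values of
  \<open>g\<close> on \<open>P\<close> then recovers \<open>t\<close>.\<close>

lemma idx_mult:
  assumes nz: "\<And>z. z \<in> P \<Longrightarrow> ev g z \<noteq> 0"
  shows "idx P (g * h) = idx P g * idx P h"
proof -
  obtain S where S: "ideal_on.transversal P g S" using ideal_on.transversal_rep by blast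
  obtain T where T: "ideal_on.transversal P h T" using ideal_on.transversal_rep by blast
  define m where "m = (\<lambda>(s, t). s + g * t)"
  have key: "s = s' \<and> t = t'"
    if st: "s \<in> S" "s' \<in> S" "t \<in> T" "t' \<in> T" and mem: "m (s, t) - m (s', t') \<in> ideal_on P (g * h)"
    for s s' t t'
  proof -
    obtain a where a: "\<forall>z\<in>P. ev (m (s, t) - m (s', t')) z = ev (g * h) z * ev a z"
      using mem unfolding ideal_on_def by blast
    have "\<forall>z\<in>P. ev (s - s') z = ev g z * ev (h * a - t + t') z"
      using a by (auto simp: m_def algebra_simps)
    hence "s - s' \<in> ideal_on P g" unfolding ideal_on_def by blast
    hence s: "s = s'" using S st unfolding ideal_on.transversal_def by blast
    have "\<forall>z\<in>P. ev g z * ev (t - t') z = ev g z * (ev h z * ev a z)"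
      using a by (auto simp: m_def s algebra_simps)
    hence "\<forall>z\<in>P. ev (t - t') z = ev h z * ev a z" using nz by simp
    hence "t - t' \<in> ideal_on P h" unfolding ideal_on_def by blast
    hence "t = t'" using T st unfolding ideal_on.transversal_def by blast
    with s show ?thesis by simp
  qed
  have "ideal_on.transversal P (g * h) (m ` (S \<times> T))"
    unfolding ideal_on.transversal_def
  proof (intro conjI allI ballI impI)
    fix x
    obtain s where s: "s \<in> S" "x - s \<in> ideal_on P g"
      using S unfolding ideal_on.transversal_def by blast
    then obtain a where a: "\<forall>z\<in>P. ev (x - s) z = ev g z * ev a z"
      unfolding ideal_on_def by blast
    obtain t where t: "t \<in> T" "a - t \<in> ideal_on P h"
      using T unfolding ideal_on.transversal_def by blast
    then obtain b where b: "\<forall>z\<in>P. ev (a - t) z = ev h z * ev b z"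
      unfolding ideal_on_def by blast
    have "ev (x - m (s, t)) z = ev (g * h) z * ev b z" if "z \<in> P" for z
    proof -
      have "ev x z = ev s z + ev g z * ev a z" "ev a z = ev t z + ev h z * ev b z"
        using a b that by (auto simp: algebra_simps)
      thus ?thesis by (simp add: m_def algebra_simps)
    qed
    hence "x - m (s, t) \<in> ideal_on P (g * h)" unfolding ideal_on_def by blast
    thus "\<exists>r\<in>m ` (S \<times> T). x - r \<in> ideal_on P (g * h)" using s t by blast
  next
    fix u v assume "u \<in> m ` (S \<times> T)" "v \<in> m ` (S \<times> T)" "u - v \<in> ideal_on P (g * h)"
    thus "u = v" using key by blast
  qed
  hence "idx P (g * h) = card (m ` (S \<times> T))" by (simp add: ideal_on.card_transversal)
  also have "\<dots> = card (S \<times> T)"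
  proof (rule card_image, rule inj_onI)
    fix u v assume "u \<in> S \<times> T" "v \<in> S \<times> T" "m u = m v"
    thus "u = v" using key ideal_on.zero_mem[of P "g * h"] by (cases u; cases v) auto
  qed
  also have "\<dots> = idx P g * idx P h"
    using ideal_on.card_transversal S T by (simp add: card_cartesian_product)
  finally show ?thesis .
qed

lemma idx_prod:
  assumes "finite A" "\<And>a z. a \<in> A \<Longrightarrow> z \<in> P \<Longrightarrow> ev (g a) z \<noteq> 0"
  shows "idx P (\<Prod>a\<in>A. g a) = (\<Prod>a\<in>A. idx P (g a))"
  using assms by (induction A rule: finite_induct) (auto simp: idx_mult idx_1)

text \<open>The substitutions \<open>u\<close> and \<open>v\<close> induce mutually inverse
  permutations of \<open>P\<close>, so composing with \<open>u\<close> carries a transversal for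
  \<open>h\<close> to one for \<open>pcompose h u\<close>.\<close>

lemma idx_pcompose:
  assumes u: "\<And>z. z \<in> P \<Longrightarrow> ev u z \<in> P" and v: "\<And>z. z \<in> P \<Longrightarrow> ev v z \<in> P"
    and uv: "\<And>z. z \<in> P \<Longrightarrow> ev v (ev u z) = z" and vu: "\<And>z. z \<in> P \<Longrightarrow> ev u (ev v z) = z"
  shows "idx P (pcompose h u) = idx P h"
proof -
  obtain T where T: "ideal_on.transversal P h T" using ideal_on.transversal_rep by blast
  have key: "s = t" if st: "s \<in> T" "t \<in> T"
    and mem: "pcompose s u - pcompose t u \<in> ideal_on P (pcompose h u)" for s t
  proof -
    obtain a where a: "\<forall>z\<in>P. ev (pcompose s u - pcompose t u) z = ev (pcompose h u) z * ev a z"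
      using mem unfolding ideal_on_def by blast
    have "ev (s - t) z = ev h z * ev (pcompose a v) z" if "z \<in> P" for z
      using a[rule_format, OF v[OF that]] vu[OF that] by simp
    hence "s - t \<in> ideal_on P h" unfolding ideal_on_def by blast
    thus ?thesis using T st unfolding ideal_on.transversal_def by blast
  qed
  have "ideal_on.transversal P (pcompose h u) ((\<lambda>t. pcompose t u) ` T)"
    unfolding ideal_on.transversal_def
  proof (intro conjI allI ballI impI)
    fix x
    obtain t where t: "t \<in> T" "pcompose x v - t \<in> ideal_on P h"
      using T unfolding ideal_on.transversal_def by blast
    then obtain a where a: "\<forall>z\<in>P. ev (pcompose x v - t) z = ev h z * ev a z"
      unfolding ideal_on_def by blast
    have "ev (x - pcompose t u) z = ev (pcompose h u) z * ev (pcompose a u) z" if "z \<in> P" for z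
      using a[rule_format, OF u[OF that]] uv[OF that] by simp
    hence "x - pcompose t u \<in> ideal_on P (pcompose h u)" unfolding ideal_on_def by blast
    thus "\<exists>r\<in>(\<lambda>t. pcompose t u) ` T. x - r \<in> ideal_on P (pcompose h u)" using t by blast
  next
    fix x y
    assume "x \<in> (\<lambda>t. pcompose t u) ` T" "y \<in> (\<lambda>t. pcompose t u) ` T"
      "x - y \<in> ideal_on P (pcompose h u)"
    thus "x = y" using key by blast
  qed
  hence "idx P (pcompose h u) = card ((\<lambda>t. pcompose t u) ` T)"
    by (simp add: ideal_on.card_transversal)
  also have "\<dots> = card T"
  proof (rule card_image, rule inj_onI)
    fix s t assume "s \<in> T" "t \<in> T" "pcompose s u = pcompose t u"
    thus "s = t" using key ideal_on.zero_mem[of P "pcompose h u"] by simp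
  qed
  also have "\<dots> = idx P h" using T by (rule ideal_on.card_transversal)
  finally show ?thesis .
qed

subsection \<open>Norms from prime power cyclotomic fields\<close>

text \<open>The gcd of \<open>i\<close> and \<open>p ^ Suc k\<close> is some \<open>p ^ j\<close>
  with \<open>j \<le> k\<close>; multiply its Bezout relation by \<open>p ^ (k - j)\<close>. In a
  cyclic group of order \<open>p ^ Suc k\<close> this says that every nontrivial subgroup contains
  the one of order \<open>p\<close>.\<close>

lemma nat_mult_eq_prime_power_mod:
  fixes p :: nat
  assumes p: "prime p" and i: "0 < i" "i < p ^ Suc k"
  shows "\<exists>u w. i * u = p ^ Suc k * w + p ^ k"
proof -
  obtain j where j: "gcd i (p ^ Suc k) = p ^ j" "j \<le> Suc k"
    using divides_primepow_nat[OF p, of "gcd i (p ^ Suc k)" "Suc k"] by auto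
  have "j \<noteq> Suc k"
  proof
    assume "j = Suc k"
    hence "p ^ Suc k dvd i" using j(1) by (metis gcd_dvd1)
    thus False using i by (auto dest: dvd_imp_le)
  qed
  hence jk: "p ^ k = p ^ j * p ^ (k - j)" using j(2) by (simp flip: power_add)
  obtain x y where "i * x = p ^ Suc k * y + p ^ j"
    using bezout_nat[of i "p ^ Suc k"] i j(1) by auto
  hence "i * (x * p ^ (k - j)) = p ^ Suc k * (y * p ^ (k - j)) + p ^ k"
    unfolding jk by (metis (no_types, lifting) add_mult_distrib mult.assoc)
  thus ?thesis by blast
qed

lemma not_dvd_power_of_other_prime:
  assumes "prime (p :: nat)" "prime l" "p \<noteq> l"
  shows "\<not> int p dvd int l ^ n"
proof
  assume "int p dvd int l ^ n"
  hence "p dvd l ^ n" by (simp flip: of_nat_power add: int_dvd_int_iff)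
  hence "p dvd l" using assms(1) prime_dvd_power_nat by blast
  thus False using assms primes_dvd_imp_eq by blast
qed

section \<open>Primitive roots of unity and the cyclotomic polynomial\<close>

locale prime_power_roots =
  fixes p k :: nat
  assumes p: "prime p"
begin

text \<open>These are the primitive \<open>p ^ Suc k\<close>-th roots of unity: the order divides
  \<open>p ^ Suc k\<close> but not \<open>p ^ k\<close>.\<close>

definition P :: "complex set" where
  "P = {z. z ^ (p ^ Suc k) = 1 \<and> z ^ (p ^ k) \<noteq> 1}"

text \<open>Euler's totient of \<open>p ^ Suc k\<close>: the size of \<open>P\<close> and of
  \<open>A\<close>, and the degree of \<open>Phi\<close>.\<close>

definition D :: nat where "D = (p - 1) * p ^ k"

text \<open>The \<open>p ^ Suc k\<close>-th cyclotomic polynomial, written as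
  \<open>1 + s + ... + s ^ (p - 1)\<close> with \<open>s = t ^ (p ^ k)\<close>.\<close>

definition Phi :: "int poly" where
  "Phi = (\<Sum>i<p. monom 1 (i * p ^ k))"

text \<open>The units modulo \<open>p ^ Suc k\<close>: the exponents \<open>a\<close> for which t
  \<mapsto> t^a is a conjugation.\<close>

definition A :: "nat set" where
  "A = {a. a < p ^ Suc k \<and> coprime a p}"

lemma p_pos: "p > 0" "p > 1"
  using p prime_gt_0_nat prime_gt_1_nat by blast+

lemma D_pos: "D > 0"
  using p_pos by (simp add: D_def)

lemma finite_P: "finite P"
proof -
  have "finite {z::complex. z ^ (p ^ Suc k) = 1}"
    using p_pos by (intro finite_roots_unity) auto
  thus ?thesis by (rule rev_finite_subset) (auto simp: P_def)
qed

lemma power_pk_eq_1: "z ^ (p ^ k) = 1 \<Longrightarrow> z ^ (p ^ Suc k) = 1" for z :: complex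
  by (simp add: power_mult mult.commute[of p])

lemma roots_split: "{z. z ^ (p ^ Suc k) = 1} = {z. z ^ (p ^ k) = 1} \<union> P"
  using power_pk_eq_1 by (auto simp: P_def)

lemma card_P: "card P = D"
proof -
  have fin: "finite {z::complex. z ^ (p ^ k) = 1}"
    using p_pos by (intro finite_roots_unity) auto
  have "card {z::complex. z ^ (p ^ Suc k) = 1} = card {z::complex. z ^ (p ^ k) = 1} + card P"
    unfolding roots_split using finite_P fin by (intro card_Un_disjoint) (auto simp: P_def)
  moreover have "card {z::complex. z ^ (p ^ Suc k) = 1} = p ^ Suc k"
    using p_pos by (intro card_roots_unity_eq) auto
  moreover have "card {z::complex. z ^ (p ^ k) = 1} = p ^ k"
    using p_pos by (intro card_roots_unity_eq) auto
  ultimately show ?thesis by (simp add: D_def diff_mult_distrib)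
qed

lemma ev_Phi: "z \<in> P \<Longrightarrow> ev Phi z = 0"
proof -
  assume z: "z \<in> P"
  have "ev Phi z = (\<Sum>i<p. (z ^ (p ^ k)) ^ i)"
    by (simp add: Phi_def power_mult mult.commute flip: power_mult)
  also have "\<dots> = 0"
    using z by (subst sum_gp_strict) (auto simp: P_def mult.commute[of p] simp flip: power_mult)
  finally show ?thesis .
qed

lemma poly_Phi_1: "poly Phi 1 = int p"
  by (simp add: Phi_def poly_sum poly_monom)

lemma degree_Phi: "degree Phi = D" and lead_coeff_Phi: "coeff Phi D = 1"
proof -
  have coeff: "coeff Phi n = (\<Sum>i<p. if i * p ^ k = n then 1 else 0)" for n
    by (simp add: Phi_def coeff_sum)
  have "coeff Phi D = (\<Sum>i<p. if i = p - 1 then 1 else 0)"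
    unfolding coeff using p_pos by (intro sum.cong) (auto simp: D_def)
  thus l: "coeff Phi D = 1" using p_pos by simp
  show "degree Phi = D"
  proof (rule antisym)
    show "degree Phi \<le> D"
    proof (rule degree_le, intro allI impI)
      fix n assume n: "D < n"
      have "i * p ^ k \<noteq> n" if "i < p" for i
      proof -
        have "i * p ^ k \<le> D" unfolding D_def using that by (intro mult_right_mono) auto
        thus ?thesis using n by simp
      qed
      thus "coeff Phi n = 0" unfolding coeff by (intro sum.neutral) auto
    qed
    show "D \<le> degree Phi" using l by (intro le_degree) simp
  qed
qed

lemma division:
  obtains r s where "x = Phi * s + r" "degree r < D"
proof -
  \<comment> \<open>As \<open>Phi\<close> is monic, the scaling factor of pseudo-division is 1 and
    this is genuine division over the integers.\<close>
  obtain s r where sr: "pseudo_divmod x Phi = (s, r)" by fastforce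
  have "Phi \<noteq> 0" using lead_coeff_Phi by auto
  from pseudo_divmod[OF this sr] have "x = Phi * s + r" "degree r < D"
    using D_pos by (auto simp: degree_Phi lead_coeff_Phi)
  thus thesis by (rule that)
qed

lemma residue:
  obtains r where "degree r < D" "\<And>z. z \<in> P \<Longrightarrow> ev r z = ev x z"
proof -
  obtain r s where rs: "x = Phi * s + r" "degree r < D" by (rule division)
  show thesis by (rule that[OF rs(2)]) (use rs(1) in \<open>simp add: ev_Phi\<close>)
qed

text \<open>The polynomials with \<open>D\<close> coefficients in \<open>{0..<m}\<close> form a
  transversal: division by \<open>Phi\<close> brings the degree below \<open>D\<close>, and the
  coefficients are then reduced modulo \<open>m\<close>.\<close>

lemma idx_const:
  assumes m: "m > 0"
  shows "idx P [:m:] = nat m ^ D"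
proof -
  define L where "L = {xs. set xs \<subseteq> {0..<m} \<and> length xs = D}"
  have coeffP: "0 \<le> coeff (Poly xs) i \<and> coeff (Poly xs) i < m" if "xs \<in> L" for xs i
    using that m unfolding L_def by (auto simp: nth_default_def subset_iff)
  have degP: "degree (Poly xs) < D" if "xs \<in> L" for xs
    using that D_pos by (intro degree_lessI) (auto simp: L_def nth_default_def)
  have key: "xs = ys"
    if xy: "xs \<in> L" "ys \<in> L" and mem: "Poly xs - Poly ys \<in> ideal_on P [:m:]" for xs ys
  proof -
    obtain a where a: "\<forall>z\<in>P. ev (Poly xs - Poly ys) z = of_int m * ev a z"
      using mem unfolding ideal_on_def by auto
    obtain b where b: "degree b < D" "\<And>z. z \<in> P \<Longrightarrow> ev b z = ev a z" by (rule residue[of a]) auto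
    \<comment> \<open>\<open>d\<close> has degree below \<open>D\<close> and vanishes at the
      \<open>D\<close> points of \<open>P\<close>, so it is zero. This turns a congruence on
      \<open>P\<close> into an identity of coefficients.\<close>
    define d where "d = Poly xs - Poly ys - smult m b"
    have "degree d < card P"
      unfolding d_def card_P by (intro degree_diff_less) (use degP xy b m in auto)
    hence "d = 0"
      by (rule ev_eq_0_imp_zero[OF finite_P]) (use a b in \<open>simp add: d_def\<close>)
    hence eq: "Poly xs - Poly ys = smult m b" by (simp add: d_def)
    have "coeff (Poly xs) i = coeff (Poly ys) i" for i
    proof -
      have "coeff (Poly xs) i - coeff (Poly ys) i = m * coeff b i"
        using arg_cong[OF eq, of "\<lambda>f. coeff f i"] by simp
      hence "coeff (Poly xs) i mod m = coeff (Poly ys) i mod m"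
        by (metis mod_eq_dvd_iff dvd_triv_left)
      thus ?thesis using coeffP[OF xy(1), of i] coeffP[OF xy(2), of i] by simp
    qed
    hence "nth_default 0 xs = nth_default 0 ys" by auto
    moreover have "length xs = length ys" using xy by (simp add: L_def)
    ultimately show ?thesis
      by (metis nth_default_nth nth_equalityI)
  qed
  have "ideal_on.transversal P [:m:] (Poly ` L)"
    unfolding ideal_on.transversal_def
  proof (intro conjI allI ballI impI)
    fix x
    obtain r where r: "degree r < D" "\<And>z. z \<in> P \<Longrightarrow> ev r z = ev x z" by (rule residue[of x]) auto
    define xs where "xs = map (\<lambda>i. coeff r i mod m) [0..<D]"
    have xs: "xs \<in> L" using m by (auto simp: xs_def L_def)
    have "r - Poly xs = smult m (map_poly (\<lambda>c. c div m) r)"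
    proof (rule poly_eqI)
      fix i
      show "coeff (r - Poly xs) i = coeff (smult m (map_poly (\<lambda>c. c div m) r)) i"
        using r(1) by (cases "i < D")
          (auto simp: xs_def nth_default_def coeff_map_poly coeff_eq_0 minus_mod_eq_mult_div)
    qed
    hence "\<forall>z\<in>P. ev (x - Poly xs) z = ev [:m:] z * ev (map_poly (\<lambda>c. c div m) r) z"
      using r(2) by (metis ev_diff ev_smult ev_pCons ev_0 mult_zero_right add_0_right)
    hence "x - Poly xs \<in> ideal_on P [:m:]" unfolding ideal_on_def by blast
    thus "\<exists>t\<in>Poly ` L. x - t \<in> ideal_on P [:m:]" using xs by blast
  next
    fix s t assume "s \<in> Poly ` L" "t \<in> Poly ` L" "s - t \<in> ideal_on P [:m:]"
    thus "s = t" using key by blast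
  qed
  hence "idx P [:m:] = card (Poly ` L)" by (simp add: ideal_on.card_transversal)
  also have "\<dots> = card L"
  proof (rule card_image, rule inj_onI)
    fix xs ys assume "xs \<in> L" "ys \<in> L" "Poly xs = Poly ys"
    thus "xs = ys" using key ideal_on.zero_mem[of P "[:m:]"] by simp
  qed
  also have "\<dots> = nat m ^ D"
    unfolding L_def by (subst card_lists_length_eq) auto
  finally show ?thesis .
qed

lemma power_mem_P:
  assumes z: "z \<in> P" and a: "coprime a p"
  shows "z ^ a \<in> P"
proof -
  have q: "z ^ (p ^ Suc k) = 1" using z by (simp add: P_def)
  have "(z ^ a) ^ (p ^ Suc k) = (z ^ (p ^ Suc k)) ^ a"
    by (metis power_mult mult.commute)
  moreover have "(z ^ a) ^ (p ^ k) \<noteq> 1"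
  proof
    assume e: "(z ^ a) ^ (p ^ k) = 1"
    have "a \<noteq> 0" using a p_pos by (intro notI) auto
    \<comment> \<open>\<open>x\<close> inverts \<open>a\<close> modulo \<open>p\<close>, so raising
      to the power \<open>x\<close> undoes the exponent \<open>a\<close> on
      \<open>z ^ (p ^ k)\<close>, whose \<open>p\<close>-th power is 1.\<close>
    then obtain x y where xy: "a * x = p * y + 1"
      using bezout_nat[of a p] a by (auto simp: coprime_iff_gcd_eq_1)
    have "1 = (z ^ (p ^ k)) ^ (a * x)"
      using e by (metis power_mult mult.commute power_one)
    also have "\<dots> = (z ^ (p ^ Suc k)) ^ y * z ^ (p ^ k)"
      unfolding xy by (simp add: power_add mult_ac flip: power_mult)
    also have "\<dots> = z ^ (p ^ k)" using q by simp
    finally show False using z by (simp add: P_def)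
  qed
  ultimately show ?thesis using q by (simp add: P_def)
qed

text \<open>An element of \<open>P\<close> has exact order \<open>p ^ Suc k\<close>, so its powers
  are distinct and by counting exhaust all \<open>p ^ Suc k\<close>-th roots of unity; those in
  \<open>P\<close> have exponent prime to \<open>p\<close>.\<close>

lemma bij_powers:
  assumes z: "z \<in> P"
  shows "bij_betw (\<lambda>a. z ^ a) A P"
proof -
  have q: "z ^ (p ^ Suc k) = 1" using z by (simp add: P_def)
  have nz: "z \<noteq> 0" using q p_pos by (intro notI) (auto simp: zero_power)
  have ne: "z ^ i \<noteq> 1" if i: "0 < i" "i < p ^ Suc k" for i
  proof
    assume e: "z ^ i = 1"
    obtain u w where uw: "i * u = p ^ Suc k * w + p ^ k"
      using nat_mult_eq_prime_power_mod[OF p i] by blast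
    have "1 = z ^ (i * u)" by (simp add: power_mult e)
    also have "\<dots> = z ^ (p ^ k)" unfolding uw power_add power_mult[of z "p ^ Suc k" w] q by simp
    finally show False using z by (simp add: P_def)
  qed
  have inj: "inj_on (\<lambda>a. z ^ a) {..<p ^ Suc k}"
  proof (rule linorder_inj_onI)
    fix i j assume ij: "i < j" "i \<in> {..<p ^ Suc k}" "j \<in> {..<p ^ Suc k}"
    have "z ^ j = z ^ i * z ^ (j - i)" using ij by (simp flip: power_add)
    thus "z ^ i \<noteq> z ^ j" using ne[of "j - i"] ij nz by auto
  qed auto
  have "(\<lambda>a. z ^ a) ` {..<p ^ Suc k} = {x. x ^ (p ^ Suc k) = 1}"
  proof (rule card_subset_eq)
    show "finite {x::complex. x ^ (p ^ Suc k) = 1}"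
      using p_pos by (intro finite_roots_unity) auto
    show "(\<lambda>a. z ^ a) ` {..<p ^ Suc k} \<subseteq> {x. x ^ (p ^ Suc k) = 1}"
      using q by (auto simp flip: power_mult) (metis mult.commute power_mult power_one)
    show "card ((\<lambda>a. z ^ a) ` {..<p ^ Suc k}) = card {x::complex. x ^ (p ^ Suc k) = 1}"
      using card_image[OF inj] card_roots_unity_eq[of "p ^ Suc k"] p_pos by simp
  qed
  hence surj: "\<exists>a<p ^ Suc k. x = z ^ a" if "x \<in> P" for x
    using that by (fastforce simp: P_def)
  have cop: "coprime a p" if "z ^ a \<in> P" for a
  proof (rule ccontr)
    assume "\<not> coprime a p"
    hence "p dvd a" using p by (metis coprime_commute prime_imp_coprime)
    then obtain b where b: "a = p * b" by blast
    have "(z ^ a) ^ (p ^ k) = (z ^ (p ^ Suc k)) ^ b"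
      unfolding b by (simp add: mult_ac flip: power_mult)
    thus False using that q by (simp add: P_def)
  qed
  show ?thesis
    unfolding bij_betw_def
  proof
    show "inj_on (\<lambda>a. z ^ a) A" using inj by (rule inj_on_subset) (auto simp: A_def)
    show "(\<lambda>a. z ^ a) ` A = P"
      using power_mem_P[OF z] surj cop by (fastforce simp: A_def)
  qed
qed

lemma P_nonempty: "P \<noteq> {}"
  using card_P D_pos by auto

lemma card_A: "card A = D"
  using P_nonempty bij_powers bij_betw_same_card card_P by fastforce

text \<open>The inverse substitution is t \<mapsto> t^b, with \<open>b\<close> an inverse of
  \<open>a\<close> modulo \<open>p ^ Suc k\<close>.\<close>

lemma idx_conjugate:
  assumes a: "coprime a p"
  shows "idx P (pcompose h (monom 1 a)) = idx P h"
proof -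
  have "a \<noteq> 0" using a p_pos by (intro notI) auto
  moreover have "gcd a (p ^ Suc k) = 1" using a by simp
  ultimately obtain b y where b: "a * b = p ^ Suc k * y + 1"
    using bezout_nat[of a "p ^ Suc k"] by auto
  have "coprime (p ^ Suc k * y + 1) (p ^ Suc k * y)"
    by (simp only: coprime_add_one_left)
  hence "coprime (a * b) p" unfolding b by (simp add: mult.assoc)
  hence bp: "coprime b p" by simp
  have ab: "z ^ (a * b) = z" if "z \<in> P" for z
    using that unfolding b power_add power_mult by (simp add: P_def)
  show ?thesis
  proof (rule idx_pcompose[where v = "monom 1 b"])
    fix z assume z: "z \<in> P"
    show "ev (monom 1 a) z \<in> P" "ev (monom 1 b) z \<in> P"
      using power_mem_P[OF z a] power_mem_P[OF z bp] by auto
    show "ev (monom 1 b) (ev (monom 1 a) z) = z"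
      using ab[OF z] by (simp flip: power_mult)
    show "ev (monom 1 a) (ev (monom 1 b) z) = z"
      using ab[OF z] by (simp add: mult.commute flip: power_mult)
  qed
qed

section \<open>The norm as an integer and as an index\<close>

definition conj_prod :: "int poly \<Rightarrow> int poly" where
  "conj_prod h = (\<Prod>a\<in>A. pcompose h (monom 1 a))"

lemma ev_conj_prod: "z \<in> P \<Longrightarrow> ev (conj_prod h) z = (\<Prod>w\<in>P. ev h w)"
  unfolding conj_prod_def using prod.reindex_bij_betw[OF bij_powers, of z "ev h"] by simp

text \<open>The remainder of \<open>conj_prod h\<close> modulo \<open>Phi\<close> has degree below
  \<open>D\<close> and takes one value \<open>c\<close> at all \<open>D\<close> points of
  \<open>P\<close>; hence it is the constant \<open>c\<close>, which is therefore an integer. The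
  quotient \<open>s\<close> is kept so that the identity can be evaluated at 1, a point outside
  \<open>P\<close>.\<close>

lemma norm_exists: "\<exists>N s. conj_prod h = Phi * s + [:N:] \<and> (\<Prod>w\<in>P. ev h w) = of_int N"
proof -
  obtain r s where rs: "conj_prod h = Phi * s + r" "degree r < D" by (rule division)
  define c where "c = (\<Prod>w\<in>P. ev h w)"
  have r: "poly (map_poly of_int r - [:c:]) z = 0" if "z \<in> P" for z
    using ev_conj_prod[OF that, of h] that unfolding rs(1) by (simp add: ev_Phi c_def flip: ev_def)
  have "map_poly of_int r - [:c:] = (0 :: complex poly)"
  proof (rule ccontr)
    assume nz: "map_poly of_int r - [:c:] \<noteq> (0 :: complex poly)"
    have "D \<le> card {z. poly (map_poly of_int r - [:c:]) z = 0}"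
      unfolding card_P[symmetric] using r by (intro card_mono poly_roots_finite nz) auto
    also have "\<dots> \<le> degree (map_poly of_int r - [:c:] :: complex poly)"
      by (rule card_poly_roots_bound) (rule nz)
    also have "\<dots> < D"
      using rs(2) D_pos by (intro degree_diff_less) (auto simp: degree_map_poly)
    finally show False by simp
  qed
  hence eq: "map_poly of_int r = [:c:]" by simp
  have r0: "r = [:coeff r 0:]"
  proof (rule poly_eqI)
    fix i
    show "coeff r i = coeff [:coeff r 0:] i"
      using arg_cong[OF eq, of "\<lambda>f. coeff f i"] by (cases i) (auto simp: coeff_map_poly)
  qed
  have "c = of_int (coeff r 0)"
    using arg_cong[OF eq, of "\<lambda>f. coeff f 0"] by (simp add: coeff_map_poly)
  thus ?thesis using rs(1) r0 unfolding c_def by metis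
qed

definition N :: "int poly \<Rightarrow> int" where
  "N h = (THE n. of_int n = (\<Prod>w\<in>P. ev h w))"

lemma of_int_N: "of_int (N h) = (\<Prod>w\<in>P. ev h w)"
  unfolding N_def by (rule theI') (metis norm_exists of_int_eq_iff)

text \<open>Evaluate the division identity at 1: each conjugate of \<open>h\<close> has the value
  \<open>poly h 1\<close> there and \<open>Phi\<close> has the value \<open>p\<close>, so the norm
  is congruent to \<open>poly h 1 ^ D\<close> modulo \<open>p\<close>.\<close>

lemma dvd_N_iff: "int p dvd N h \<longleftrightarrow> int p dvd poly h 1"
proof -
  obtain M s where M: "conj_prod h = Phi * s + [:M:]" "of_int M = (\<Prod>w\<in>P. ev h w)"
    using norm_exists[of h] by metis
  have "M = N h" using M(2) of_int_N[of h] by (metis of_int_eq_iff)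
  moreover have "poly (conj_prod h) 1 = poly h 1 ^ D"
    by (simp add: conj_prod_def poly_prod poly_pcompose poly_monom card_A)
  ultimately have eq: "poly h 1 ^ D = int p * poly s 1 + N h"
    using arg_cong[OF M(1), of "\<lambda>f. poly f 1"] by (simp add: poly_Phi_1)
  have "int p dvd poly h 1 \<longleftrightarrow> int p dvd poly h 1 ^ D"
    using p D_pos by (simp add: prime_dvd_power_iff)
  thus ?thesis unfolding eq by (simp add: dvd_add_right_iff)
qed

lemma idx_eq_norm:
  assumes nz: "N h \<noteq> 0"
  shows "idx P h = nat \<bar>N h\<bar>"
proof -
  have "(\<Prod>w\<in>P. ev h w) \<noteq> 0"
    using nz by (simp flip: of_int_N)
  hence evnz: "ev h z \<noteq> 0" if "z \<in> P" for z
    using that finite_P by auto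
  have "idx P h ^ D = idx P (conj_prod h)"
  proof -
    have "idx P (conj_prod h) = (\<Prod>a\<in>A. idx P (pcompose h (monom 1 a)))"
      unfolding conj_prod_def by (rule idx_prod) (auto simp: A_def evnz power_mem_P)
    also have "\<dots> = (\<Prod>a\<in>A. idx P h)"
      by (rule prod.cong) (auto simp: A_def idx_conjugate)
    finally show ?thesis by (simp add: card_A)
  qed
  also have "ideal_on P (conj_prod h) = ideal_on P [:N h:]"
    by (rule ideal_on_cong) (simp add: ev_conj_prod of_int_N)
  \<comment> \<open>A change of sign leaves the ideal unchanged and supplies the positive constant
    that \<open>idx_const\<close> requires.\<close>
  also have "ideal_on P [:N h:] = ideal_on P [:\<bar>N h\<bar>:]"
  proof (cases "N h \<ge> 0")
    case False
    show ?thesis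
    proof (rule Set.set_eqI)
      fix x
      have "(\<exists>a. \<forall>z\<in>P. ev x z = of_int (N h) * ev a z) \<longleftrightarrow>
        (\<exists>a. \<forall>z\<in>P. ev x z = of_int (- N h) * ev a z)"
        by (rule iffI; elim exE; rule_tac x = "- a" in exI) auto
      thus "x \<in> ideal_on P [:N h:] \<longleftrightarrow> x \<in> ideal_on P [:\<bar>N h\<bar>:]"
        using False by (simp add: ideal_on_def)
    qed
  qed simp
  also have "idx P [:\<bar>N h\<bar>:] = nat \<bar>N h\<bar> ^ D"
    using nz by (intro idx_const) simp
  finally show ?thesis using D_pos by (simp add: power_eq_iff_eq_base)
qed

section \<open>Multiplication by t on the residue classes\<close>

lemma power_diff_mem:
  assumes "(monom 1 n - 1) * x \<in> ideal_on P h"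
  shows "(monom 1 (n * j) - 1) * x \<in> ideal_on P h"
proof (induction j)
  case 0
  show ?case by (simp add: ideal_on.zero_mem flip: one_pCons)
next
  case (Suc j)
  \<comment> \<open>Telescoping: t^(n(j+1)) - 1 = t^(nj) (t^n - 1) + (t^(nj) - 1).\<close>
  have "(monom 1 (n * Suc j) - 1) * x =
      monom 1 (n * j) * ((monom 1 n - 1) * x) + (monom 1 (n * j) - 1) * x"
    by (simp add: algebra_simps mult_monom flip: mult.assoc)
  thus ?case using Suc assms by (simp only: ideal_on.add_mem ideal_on.mult_mem)
qed

text \<open>If \<open>t ^ i\<close> with \<open>0 < i < p ^ Suc k\<close> fixes \<open>x\<close>, then so does \<open>s = t ^ (p ^ k)\<close>, whence
  \<open>0 = \<Phi> x = (1 + s + \<dots> + s ^ (p - 1)) x = p x\<close>.\<close>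
lemma fixed_imp_p_torsion:
  assumes i: "0 < i" "i < p ^ Suc k" and fx: "(monom 1 i - 1) * x \<in> ideal_on P h"
  shows "of_nat p * x \<in> ideal_on P h"
proof -
  obtain u w where uw: "i * u = p ^ Suc k * w + p ^ k"
    using nat_mult_eq_prime_power_mod[OF p i] by blast
  have "(monom 1 (i * u) - 1) * x \<in> ideal_on P h"
    using fx by (rule power_diff_mem)
  moreover have "ev (monom 1 (i * u)) z = ev (monom 1 (p ^ k)) z" if "z \<in> P" for z
    using that unfolding uw by (simp add: power_add power_mult P_def)
  ultimately have "(monom 1 (p ^ k) - 1) * x \<in> ideal_on P h"
    unfolding ideal_on_def by simp
  hence s: "(monom 1 (p ^ k * j) - 1) * x \<in> ideal_on P h" for j
    by (rule power_diff_mem)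
  have "(\<Sum>j<m. (monom 1 (p ^ k * j) - 1) * x) \<in> ideal_on P h" for m
    by (induction m) (auto intro: ideal_on.zero_mem ideal_on.add_mem s)
  moreover have "(\<Sum>j<p. (monom 1 (p ^ k * j) - 1) * x) = (Phi - of_nat p) * x"
    unfolding Phi_def
    by (simp add: sum_subtractf mult.commute[of "p ^ k"] flip: sum_distrib_right)
  ultimately have "(Phi - of_nat p) * x \<in> ideal_on P h" by metis
  hence "- ((Phi - of_nat p) * x) \<in> ideal_on P h" by (rule ideal_on.minus_mem)
  thus ?thesis unfolding ideal_on_def by (simp add: ev_Phi)
qed

text \<open>The \<open>l\<close>-primary part \<open>X\<close> of the quotient has
  \<open>l ^ v\<close> elements, where \<open>l ^ v\<close> is the \<open>l\<close>-part of the
  norm. Counting the free orbits of \<open>g\<close> on its nonzero elements \<open>Y\<close> shows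
  that \<open>p ^ Suc k\<close> divides \<open>l ^ v - 1\<close>.\<close>

lemma primary_part_norm_cong:
  assumes nz: "N h \<noteq> 0" and l: "prime l" "l \<noteq> p"
  shows "[l_part l (N h) = 1] (mod int p ^ Suc k)"
proof -
  define I where "I = ideal_on P h"
  interpret I: int_poly_ideal I unfolding I_def by (rule int_poly_ideal_ideal_on)
  define v where "v = multiplicity (int l) (N h)"
  define G where "G = I.quotient_group"
  interpret G: comm_group G unfolding G_def by (rule I.comm_group_quotient)
  have l1: "prime (int l)" "\<not> is_unit (int l)" using l by auto
  obtain c where c: "N h = int l ^ v * c" "\<not> int l dvd c"
    using multiplicity_decompose'[OF nz l1(2)] unfolding v_def by metis
  have card: "card (range I.rep) = nat \<bar>N h\<bar>"
    using idx_eq_norm[OF nz] unfolding I_def[symmetric] I.index_def .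
  have fin: "finite (range I.rep)"
    using card nz by (intro card_ge_0_finite) simp
  have carrier: "carrier G = range I.rep" and one: "\<one>\<^bsub>G\<^esub> = I.rep 0"
    by (auto simp: G_def I.quotient_group_def)
  define X where "X = {x \<in> range I.rep. of_nat (l ^ v) * x \<in> I}"
  have cardX: "card X = l ^ v"
  proof -
    have "card {x \<in> carrier G. x [^]\<^bsub>G\<^esub> (l ^ v) = \<one>\<^bsub>G\<^esub>} = l ^ v"
    proof (rule G.card_primary_part[where m = "nat \<bar>c\<bar>"])
      show "Coset.order G = l ^ v * nat \<bar>c\<bar>"
        unfolding Coset.order_def carrier card c(1) by (simp add: abs_mult nat_mult_distrib nat_power_eq)
      show "\<not> l dvd nat \<bar>c\<bar>" using c(2) by (simp add: int_dvd_int_iff[symmetric])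
    qed (use fin l carrier in auto)
    also have "{x \<in> carrier G. x [^]\<^bsub>G\<^esub> (l ^ v) = \<one>\<^bsub>G\<^esub>} = X"
      unfolding X_def carrier one
      by (rule Collect_cong, rule conj_cong) (simp_all add: G_def I.pow_quotient I.rep_eq_iff)
    finally show ?thesis .
  qed
  define Y where "Y = X - {I.rep 0}"
  define g where "g x = I.rep (monom 1 1 * x)" for x
  have gpow: "(g ^^ i) x = I.rep (monom 1 i * x)" if "x \<in> range I.rep" for i x
  proof (induction i)
    case 0
    thus ?case using that by (auto simp: monom_0)
  next
    case (Suc i)
    thus ?case by (simp add: g_def mult_monom flip: mult.assoc)
  qed
  have full: "I.rep (monom 1 (p ^ Suc k) * x) = x" if "x \<in> range I.rep" for x
  proof -
    have "monom 1 (p ^ Suc k) * x - x \<in> I"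
      unfolding I_def ideal_on_def by (auto simp: P_def intro!: exI[of _ 0])
    hence "I.rep (monom 1 (p ^ Suc k) * x) = I.rep x" by (simp only: I.rep_eq_iff)
    thus ?thesis using that by auto
  qed
  have fixpt: "x = I.rep 0" if x: "x \<in> X" and px: "of_nat p * x \<in> I" for x
  proof -
    have "coprime p (l ^ v)" using p l by (simp add: primes_coprime)
    hence "gcd p (l ^ v) = 1" by simp
    \<comment> \<open>Because \<open>p\<close> and \<open>l ^ v\<close> are coprime, a class killed
      by both is zero.\<close>
    then obtain a b where ab: "p * a = l ^ v * b + 1"
      using bezout_nat[of p "l ^ v"] p_pos by auto
    have "of_nat a * (of_nat p * x) - of_nat b * (of_nat (l ^ v) * x) \<in> I"
      by (rule I.diff_mem; rule I.mult_mem) (use px x in \<open>auto simp: X_def\<close>)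
    also have "of_nat a * (of_nat p * x) - of_nat b * (of_nat (l ^ v) * x) =
        of_nat (p * a) * x - of_nat (l ^ v * b) * x"
      by (simp add: algebra_simps)
    also have "\<dots> = x" unfolding ab by (simp add: algebra_simps)
    finally have "I.rep x = I.rep 0" by (simp add: I.rep_eq_iff)
    thus ?thesis using x by (auto simp: X_def)
  qed
  have "p ^ Suc k dvd card Y"
  proof (rule dvd_card_if_free_orbits[where g = g])
    show "finite Y" using fin by (simp add: Y_def X_def)
    show "p ^ Suc k > 0" using p_pos by simp
    fix y assume y: "y \<in> Y"
    hence yr: "y \<in> range I.rep" by (auto simp: Y_def X_def)
    show "(g ^^ (p ^ Suc k)) y = y" using gpow[OF yr] full[OF yr] by simp
    show free: "(g ^^ i) y \<noteq> y" if i: "0 < i" "i < p ^ Suc k" for i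
    proof
      assume "(g ^^ i) y = y"
      hence "I.rep (monom 1 i * y) = I.rep y" using gpow[OF yr] yr by auto
      hence "(monom 1 i - 1) * y \<in> I" by (simp add: I.rep_eq_iff algebra_simps)
      hence "of_nat p * y \<in> I" unfolding I_def by (rule fixed_imp_p_torsion[OF i])
      thus False using fixpt y by (auto simp: Y_def)
    qed
    show "g y \<in> Y"
    proof -
      have "of_nat (l ^ v) * y \<in> I" using y by (auto simp: Y_def X_def)
      hence "I.rep (of_nat (l ^ v) * (monom 1 1 * y)) = I.rep 0"
        using I.mult_mem[of "of_nat (l ^ v) * y" "monom 1 1"] by (simp add: I.rep_eq_iff mult_ac)
      hence "I.rep (of_nat (l ^ v) * g y) = I.rep 0" by (simp add: g_def)
      hence "of_nat (l ^ v) * g y \<in> I" by (simp only: I.rep_eq_iff diff_zero)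
      hence "g y \<in> X" by (simp add: X_def g_def)
      moreover have "g y \<noteq> I.rep 0"
      proof
        assume e: "g y = I.rep 0"
        \<comment> \<open>A full period of \<open>g\<close> returns to \<open>y\<close>; if its
          first step reached zero, all later steps would stay there.\<close>
        have "y = (g ^^ Suc (p ^ Suc k - 1)) y"
          using gpow[OF yr] full[OF yr] p_pos by simp
        also have "\<dots> = (g ^^ (p ^ Suc k - 1)) (I.rep 0)"
          by (simp only: funpow_Suc_right o_apply e)
        also have "\<dots> = I.rep 0" by (simp add: gpow)
        finally show False using y by (simp add: Y_def)
      qed
      ultimately show ?thesis by (simp add: Y_def)
    qed
  qed
  moreover have "I.rep 0 \<in> X"
    using I.mult_mem[OF I.minus_mem[OF I.diff_rep_mem[of 0]]] by (simp add: X_def)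
  hence "card Y = l ^ v - 1" using fin cardX by (simp add: Y_def X_def)
  ultimately have "int (p ^ Suc k) dvd int (l ^ v - 1)" by (simp only: int_dvd_int_iff)
  hence "int p ^ Suc k dvd int l ^ v - 1"
    using l by (simp add: of_nat_diff prime_gt_0_nat Suc_leI)
  thus ?thesis by (simp add: l_part_def v_def cong_iff_dvd_diff)
qed

text \<open>For \<open>k > 0\<close> no element of \<open>P\<close> is real, so \<open>P\<close>
  consists of complex conjugate pairs and the norm is a squared modulus. The hypothesis excludes
  \<open>p = 2\<close>, \<open>k = 0\<close>, where \<open>P\<close> is the single point -1.\<close>

lemma N_nonneg:
  assumes k: "k > 0"
  shows "N h \<ge> 0"
proof -
  define U where "U = {z \<in> P. Im z > 0}"
  have Im: "Im z \<noteq> 0" if z: "z \<in> P" for z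
  proof
    assume "Im z = 0"
    then obtain x where x: "z = of_real x" by (metis complex_is_Real_iff Reals_cases)
    have "z ^ (p ^ Suc k) = 1" using z by (simp add: P_def)
    hence "x ^ (p ^ Suc k) = 1" unfolding x by (metis of_real_eq_1_iff of_real_power)
    hence "\<bar>x\<bar> ^ (p ^ Suc k) = 1" by (simp flip: power_abs)
    hence "\<bar>x\<bar> = 1" using p_pos power_eq_iff_eq_base[of "p ^ Suc k" "\<bar>x\<bar>" 1] by simp
    hence x1: "x = 1 \<or> x = -1" by auto
    show False
    proof (cases "even (p ^ k)")
      case True
      hence "z ^ (p ^ k) = 1" using x1 by (auto simp: x)
      thus False using z by (simp add: P_def)
    next
      case False
      \<comment> \<open>Here \<open>k > 0\<close> is essential: \<open>p ^ 0\<close> is odd for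
        every \<open>p\<close>. Oddness of \<open>p\<close> then rules out
        \<open>x = -1\<close>.\<close>
      hence "odd (p ^ Suc k)" using k by simp
      hence "x = 1" using x1 \<open>x ^ (p ^ Suc k) = 1\<close> by auto
      thus False using z by (simp add: P_def x)
    qed
  qed
  have cnj: "cnj z \<in> P" if "z \<in> P" for z
  proof -
    have "cnj z ^ n = 1 \<longleftrightarrow> z ^ n = 1" for n
      by (metis complex_cnj_power complex_cnj_one complex_cnj_cnj)
    thus ?thesis using that by (simp add: P_def)
  qed
  have split: "P = U \<union> cnj ` U"
  proof (rule antisym)
    show "P \<subseteq> U \<union> cnj ` U"
    proof
      fix z assume z: "z \<in> P"
      show "z \<in> U \<union> cnj ` U"
      proof (cases "Im z > 0")
        case False
        hence "cnj z \<in> U" using Im[OF z] cnj[OF z] by (simp add: U_def)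
        thus ?thesis by (metis UnI2 complex_cnj_cnj imageI)
      qed (simp add: U_def z)
    qed
  qed (auto simp: U_def cnj)
  have "finite U" using finite_P by (simp add: U_def)
  hence "(\<Prod>w\<in>P. ev h w) = (\<Prod>w\<in>U. ev h w) * (\<Prod>w\<in>cnj ` U. ev h w)"
    by (subst split, intro prod.union_disjoint) (auto simp: U_def)
  also have "(\<Prod>w\<in>cnj ` U. ev h w) = (\<Prod>w\<in>U. ev h (cnj w))"
    by (subst prod.reindex) (auto simp: inj_on_def)
  also have "\<dots> = cnj (\<Prod>w\<in>U. ev h w)" by (simp add: cnj_ev)
  finally have "complex_of_int (N h) = of_real ((cmod (\<Prod>w\<in>U. ev h w))\<^sup>2)"
    unfolding of_int_N complex_norm_square .
  hence "real_of_int (N h) = (cmod (\<Prod>w\<in>U. ev h w))\<^sup>2"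
    by (metis of_real_eq_iff of_real_of_int_eq)
  thus ?thesis by (metis of_int_0_le_iff zero_le_power2)
qed

lemma non_p_part_norm_cong:
  assumes nz: "N h \<noteq> 0" and k: "k > 0"
  shows "[non_p_part p (N h) = 1] (mod int p ^ Suc k)"
proof -
  define m where "m = non_p_part p (N h)"
  have nu: "\<not> is_unit (int p)" using p by auto
  obtain c where c: "N h = int p ^ multiplicity (int p) (N h) * c" "\<not> int p dvd c"
    using multiplicity_decompose'[OF nz nu] by metis
  have mc: "m = c"
    unfolding m_def non_p_part_def using p_pos by (subst (1) c(1)) simp
  have dvd: "\<not> int p dvd m" and eq: "N h = int p ^ multiplicity (int p) (N h) * m"
    using c unfolding mc by blast+
  have "m \<noteq> 0" using dvd by auto
  moreover have "m \<ge> 0"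
  proof -
    have "int p ^ multiplicity (int p) (N h) > 0" using p_pos by simp
    thus ?thesis using N_nonneg[OF k, of h] eq by (metis zero_le_mult_iff not_less)
  qed
  ultimately have pos: "m > 0" by simp
  have "[(\<Prod>q\<in>prime_factors m. q ^ multiplicity q m) = (\<Prod>q\<in>prime_factors m. 1)] (mod int p ^ Suc k)"
  proof (rule cong_prod)
    fix q assume q: "q \<in> prime_factors m"
    hence pq: "prime q" "q dvd m" by auto
    define l where "l = nat q"
    have ql: "q = int l" using pq(1) by (simp add: l_def prime_ge_0_int)
    have l: "prime l" "l \<noteq> p" using pq dvd by (auto simp: ql)
    \<comment> \<open>The prime \<open>q\<close> differs from \<open>p\<close>, so removing the
      power of \<open>p\<close> from the norm does not change its \<open>q\<close>-part.\<close>
    have "multiplicity q (N h) = multiplicity q m"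
    proof -
      have "multiplicity q (int p ^ multiplicity (int p) (N h) * m) =
          multiplicity q (int p ^ multiplicity (int p) (N h)) + multiplicity q m"
        using pq \<open>m \<noteq> 0\<close> p_pos by (intro prime_elem_multiplicity_mult_distrib) auto
      moreover have "multiplicity q (int p ^ multiplicity (int p) (N h)) = 0"
        using l p not_dvd_power_of_other_prime unfolding ql
        by (intro not_dvd_imp_multiplicity_0) blast
      ultimately show ?thesis using eq by simp
    qed
    thus "[q ^ multiplicity q m = 1] (mod int p ^ Suc k)"
      using primary_part_norm_cong[OF nz l] by (simp add: l_part_def ql)
  qed
  thus ?thesis
    using prime_factorization_int[OF pos] unfolding m_def by simp
qed

end

subsection \<open>Convergence of the resultants\<close>

lemma padic_convergent_if_zero:
  assumes "padic_tendsto_zero p a"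
  shows "padic_convergent p a"
  using assms unfolding padic_tendsto_zero_def padic_convergent_def by (meson dvd_diff)

text \<open>Consecutive terms differ by \<open>a n * (u n - 1)\<close>, which
  \<open>p ^ Suc n\<close> divides for \<open>n > 0\<close>. The case \<open>n = 0\<close> is left
  out because the norm may be negative at the first level.\<close>

lemma padic_convergent_if_ratio_cong:
  assumes rec: "\<And>n. a (Suc n) = a n * u n"
    and u: "\<And>n. n > 0 \<Longrightarrow> [u n = 1] (mod int p ^ Suc n)"
  shows "padic_convergent p a"
  unfolding padic_convergent_def
proof
  fix k
  \<comment> \<open>The bound \<open>Suc k\<close> keeps \<open>n\<close> positive even when
    \<open>k = 0\<close>.\<close>
  have step: "[a (Suc n) = a n] (mod int p ^ k)" if "n \<ge> Suc k" for n
  proof -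
    have "[u n = 1] (mod int p ^ k)"
      using u[of n] that by (intro cong_dvd_modulus[OF u] le_imp_power_dvd) auto
    thus ?thesis using cong_scalar_left[of "u n" 1 _ "a n"] by (simp add: rec)
  qed
  have "[a n = a (Suc k)] (mod int p ^ k)" if "n \<ge> Suc k" for n
    using that by (induction n rule: dec_induct) (auto intro: cong_trans step)
  hence "int p ^ k dvd a m - a n" if "m \<ge> Suc k" "n \<ge> Suc k" for m n
    using that by (meson cong_iff_dvd_diff cong_sym cong_trans)
  thus "\<exists>N. \<forall>m\<ge>N. \<forall>n\<ge>N. int p ^ k dvd a m - a n" by blast
qed

lemma not_padic_tendsto_zero:
  assumes "\<And>n. \<not> int p dvd a n"
  shows "\<not> padic_tendsto_zero p a"
proof
  assume "padic_tendsto_zero p a"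
  then obtain M where "\<forall>n\<ge>M. int p ^ 1 dvd a n" unfolding padic_tendsto_zero_def by blast
  thus False using assms by auto
qed

lemma padic_tendsto_zero_if_power_dvd:
  assumes "\<And>n. int p ^ n dvd a n"
  shows "padic_tendsto_zero p a"
  unfolding padic_tendsto_zero_def using assms by (meson power_le_dvd)

lemma non_p_part_times_l_part:
  "non_p_part p x * l_part p x = x"
  by (simp add: non_p_part_def l_part_def multiplicity_dvd)

lemma l_part_mult:
  assumes "prime l" "x \<noteq> 0" "y \<noteq> 0"
  shows "l_part l (x * y) = l_part l x * l_part l y"
  using assms by (simp add: l_part_def prime_elem_multiplicity_mult_distrib power_add)

text \<open>Multiplicativity is inherited from \<open>l_part\<close> by cancelling the nonzero
  \<open>p\<close>-part on both sides, which avoids computing with \<open>div\<close>.\<close>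

lemma non_p_part_mult:
  assumes "prime p" "x \<noteq> 0" "y \<noteq> 0"
  shows "non_p_part p (x * y) = non_p_part p x * non_p_part p y"
proof -
  have "non_p_part p (x * y) * l_part p (x * y) =
      non_p_part p x * non_p_part p y * l_part p (x * y)"
    unfolding non_p_part_times_l_part unfolding l_part_mult[OF assms]
    by (metis (no_types) mult.assoc mult.commute non_p_part_times_l_part)
  moreover have "l_part p (x * y) \<noteq> 0" using assms by (simp add: l_part_def)
  ultimately show ?thesis by simp
qed

lemma not_dvd_non_p_part:
  assumes "prime p" "x \<noteq> 0"
  shows "\<not> int p dvd non_p_part p x"
proof
  assume "int p dvd non_p_part p x"
  hence "int p * l_part p x dvd non_p_part p x * l_part p x" by (rule mult_dvd_mono) simp
  hence "int p ^ Suc (multiplicity (int p) x) dvd x"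
    by (simp add: non_p_part_times_l_part) (simp add: l_part_def)
  thus False using assms by (subst (asm) power_dvd_iff_le_multiplicity) auto
qed

text \<open>The \<open>p ^ Suc n\<close>-th roots of unity are the \<open>p ^ n\<close>-th ones
  together with the primitive ones, which contribute the norm. The same recursion shows inductively
  that the complex products are integers, so that \<open>THE\<close> in \<open>cyc_res\<close> has a
  value.\<close>

lemma cyc_res_recurrence:
  assumes p: "prime p"
  shows "cyc_res (p ^ 0) f = poly f 1"
    and "cyc_res (p ^ Suc n) f = cyc_res (p ^ n) f * prime_power_roots.N p n f"
proof -
  define R where "R n = (\<Prod>z\<in>{z::complex. z ^ (p ^ n) = 1}. ev f z)" for n
  have cyc: "cyc_res (p ^ n) f = r" if "R n = of_int r" for n r
    unfolding cyc_res_def using that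
    by (intro the_equality) (auto simp: R_def ev_def)
  have R0: "R 0 = of_int (poly f 1)" by (simp add: R_def ev_at_1)
  thus "cyc_res (p ^ 0) f = poly f 1" by (rule cyc)
  have RSuc: "R (Suc n) = R n * of_int (prime_power_roots.N p n f)" for n
  proof -
    interpret prime_power_roots p n by unfold_locales (rule p)
    have "finite {z::complex. z ^ (p ^ n) = 1}"
      using p_pos by (intro finite_roots_unity) auto
    hence "R (Suc n) = R n * (\<Prod>z\<in>P. ev f z)"
      unfolding R_def roots_split using finite_P
      by (intro prod.union_disjoint) (auto simp: P_def)
    thus ?thesis by (simp add: of_int_N)
  qed
  have "\<exists>r. R n = of_int r" for n
  proof (induction n)
    case 0
    show ?case using R0 by blast
  next
    case (Suc n)
    thus ?case unfolding RSuc by (metis of_int_mult)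
  qed
  then obtain r where r: "R n = of_int r" by blast
  have "R (Suc n) = of_int (r * prime_power_roots.N p n f)" by (simp add: RSuc r)
  thus "cyc_res (p ^ Suc n) f = cyc_res (p ^ n) f * prime_power_roots.N p n f"
    using cyc[OF r] cyc by metis
qed

theorem theorem4p3:
  fixes p :: nat and f :: "int poly"
  assumes "prime p" and "f \<noteq> 0"
  shows "padic_convergent p (\<lambda>n. cyc_res (p ^ n) f)
    \<and> (padic_tendsto_zero p (\<lambda>n. cyc_res (p ^ n) f) \<longleftrightarrow> int p dvd poly f 1)
    \<and> ((\<forall>n. cyc_res (p ^ n) f \<noteq> 0) \<longrightarrow>
         padic_convergent p (\<lambda>n. non_p_part p (cyc_res (p ^ n) f))
       \<and> \<not> padic_tendsto_zero p (\<lambda>n. non_p_part p (cyc_res (p ^ n) f))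
       \<and> (\<forall>l::nat. prime l \<longrightarrow>
            padic_convergent p (\<lambda>n. l_part l (cyc_res (p ^ n) f))
          \<and> (padic_tendsto_zero p (\<lambda>n. l_part l (cyc_res (p ^ n) f))
               \<longleftrightarrow> l = p \<and> int p dvd poly f 1)))"
proof -
  define R where "R n = cyc_res (p ^ n) f" for n
  define M where "M n = prime_power_roots.N p n f" for n
  note p = \<open>prime p\<close>
  have loc: "prime_power_roots p" by unfold_locales (rule p)
  have R0: "R 0 = poly f 1" and RSuc: "R (Suc n) = R n * M n" for n
    using cyc_res_recurrence[OF p] by (simp_all add: R_def M_def)
  have dvdM: "int p dvd M n \<longleftrightarrow> int p dvd poly f 1" for n
    unfolding M_def by (rule prime_power_roots.dvd_N_iff[OF loc])
  \<comment> \<open>Each of the \<open>n\<close> norms in \<open>R n\<close> contributes a factor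
    \<open>p\<close>.\<close>
  have small: "int p ^ n dvd R n" if "int p dvd poly f 1" for n
  proof (induction n)
    case (Suc n)
    thus ?case using mult_dvd_mono[OF Suc, of "int p" "M n"] dvdM that
      by (simp add: RSuc mult.commute)
  qed simp
  have unit: "\<not> int p dvd R n" if "\<not> int p dvd poly f 1" for n
    using that dvdM p by (induction n) (auto simp: R0 RSuc prime_dvd_mult_iff)
  have non_p_M: "[non_p_part p (M n) = 1] (mod int p ^ Suc n)" if "M n \<noteq> 0" "n > 0" for n
    using prime_power_roots.non_p_part_norm_cong[OF loc] that unfolding M_def by blast
  have l_M: "[l_part l (M n) = 1] (mod int p ^ Suc n)" if "M n \<noteq> 0" "prime l" "l \<noteq> p" for n l
    using prime_power_roots.primary_part_norm_cong[OF loc] that unfolding M_def by blast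
  have conv: "padic_convergent p R"
  proof (cases "int p dvd poly f 1")
    case True
    thus ?thesis using small padic_convergent_if_zero padic_tendsto_zero_if_power_dvd by blast
  next
    case False
    have "[M n = 1] (mod int p ^ Suc n)" if "n > 0" for n
    proof -
      have np: "\<not> int p dvd M n" using False dvdM by simp
      \<comment> \<open>Being prime to \<open>p\<close>, the norm equals its own
        non-\<open>p\<close>-part, so \<open>non_p_M\<close> applies to \<open>M n\<close>
        itself.\<close>
      hence "non_p_part p (M n) = M n"
        by (simp add: non_p_part_def not_dvd_imp_multiplicity_0)
      moreover have "M n \<noteq> 0" using np by auto
      ultimately show ?thesis using non_p_M[of n] that by simp
    qed
    with RSuc show ?thesis by (rule padic_convergent_if_ratio_cong)
  qed
  have zero: "padic_tendsto_zero p R \<longleftrightarrow> int p dvd poly f 1"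
    using small unit padic_tendsto_zero_if_power_dvd not_padic_tendsto_zero by metis
  have parts: "padic_convergent p (\<lambda>n. non_p_part p (R n))
       \<and> \<not> padic_tendsto_zero p (\<lambda>n. non_p_part p (R n))
       \<and> (\<forall>l::nat. prime l \<longrightarrow>
            padic_convergent p (\<lambda>n. l_part l (R n))
          \<and> (padic_tendsto_zero p (\<lambda>n. l_part l (R n)) \<longleftrightarrow> l = p \<and> int p dvd poly f 1))"
    if nz: "\<forall>n. R n \<noteq> 0"
  proof (intro conjI allI impI)
    have Mnz: "M n \<noteq> 0" for n using nz RSuc[of n] by (metis mult_zero_right)
    show "padic_convergent p (\<lambda>n. non_p_part p (R n))"
      using nz Mnz p non_p_M
      by (intro padic_convergent_if_ratio_cong[where u = "\<lambda>n. non_p_part p (M n)"])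
         (auto simp: RSuc non_p_part_mult)
    show "\<not> padic_tendsto_zero p (\<lambda>n. non_p_part p (R n))"
      using nz p by (intro not_padic_tendsto_zero not_dvd_non_p_part) auto
    fix l :: nat assume l: "prime l"
    \<comment> \<open>For \<open>l \<noteq> p\<close> the ratios of the \<open>l\<close>-parts tend
      to 1 and no \<open>l\<close>-part is divisible by \<open>p\<close>. For \<open>l = p\<close>
      the \<open>p\<close>-parts either tend to 0 or are all equal to 1, according to whether
      \<open>p\<close> divides \<open>poly f 1\<close>.\<close>
    consider "l \<noteq> p" | "l = p" "int p dvd poly f 1" | "l = p" "\<not> int p dvd poly f 1" by blast
    hence "padic_convergent p (\<lambda>n. l_part l (R n))
      \<and> (padic_tendsto_zero p (\<lambda>n. l_part l (R n)) \<longleftrightarrow> l = p \<and> int p dvd poly f 1)"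
    proof cases
      case 1
      have "padic_convergent p (\<lambda>n. l_part l (R n))"
        using nz Mnz l l_M 1
        by (intro padic_convergent_if_ratio_cong[where u = "\<lambda>n. l_part l (M n)"])
           (auto simp: RSuc l_part_mult)
      moreover have "\<not> padic_tendsto_zero p (\<lambda>n. l_part l (R n))"
      proof (rule not_padic_tendsto_zero)
        show "\<not> int p dvd l_part l (R n)" for n
          using p l 1 not_dvd_power_of_other_prime unfolding l_part_def by blast
      qed
      ultimately show ?thesis using 1 by blast
    next
      case 2
      have "int p ^ n dvd l_part p (R n)" for n
        using small[OF 2(2), of n] nz p unfolding l_part_def
        by (auto intro!: le_imp_power_dvd multiplicity_geI)
      hence "padic_tendsto_zero p (\<lambda>n. l_part p (R n))"
        by (rule padic_tendsto_zero_if_power_dvd)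
      thus ?thesis using 2 padic_convergent_if_zero by blast
    next
      case 3
      have "l_part p (R n) = 1" for n
        using unit[OF 3(2), of n] by (simp add: l_part_def not_dvd_imp_multiplicity_0)
      moreover have "padic_convergent p (\<lambda>n. 1)" by (simp add: padic_convergent_def)
      moreover have "\<not> padic_tendsto_zero p (\<lambda>n. 1)"
        using p by (intro not_padic_tendsto_zero) auto
      ultimately show ?thesis using 3 by simp
    qed
    thus "padic_convergent p (\<lambda>n. l_part l (R n))"
      and "padic_tendsto_zero p (\<lambda>n. l_part l (R n)) = (l = p \<and> int p dvd poly f 1)" by blast+
  qed
  show ?thesis using conv zero parts unfolding R_def by blast
qed

end
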